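(* Let $C,n\ge 1$ be integers and let $f:\{0,1,\dots,C\}^n\to\mathbb{R}_+$ be a nonnegative submodular function. Then the Generalized Double Greedy algorithm (described in the context) is a $\frac13$-approximation for the problem $\max\{f(x): x\in\{0,1,\dots,C\}^n\}$, i.e. its output $a^{2n}$ satisfies $f(a^{2n})\ge \frac13\max_{x\in\{0,\dots,C\}^n} f(x)$, and it has running time $\mathcal{O}(CnT)$, where $T$ is the time for one call to the oracle representing $f$.
   Context: Write $[C]=\{0,1,\dots,C\}$. For $x,y\in[C]^n$, $x\vee y$ and $x\wedge y$ denote the component-wise maximum and minimum. A function $f:[C]^n\to\mathbb{R}$ is submodular if $f(x)+f(y)\ge f(x\vee y)+f(x\wedge y)$ for all $x,y\in[C]^n$. The function $f$ is given by a value oracle. For a vector $x$, $(x|x_k=c)$ denotes the vector obtained from $x$ by setting the $k$-th entry to $c$ and leaving all other entries unchanged. Generalized Double Greedy algorithm. Set $a^0=(0,\dots,0)$, $b^0=(C,\dots,C)$, $i=1$. For $k=1,\dots,n$ do the following. Compute $\delta_{a,i}=\max_{c\in[C]} f(a^{i-1}|a^{i-1}_k=c)-f(a^{i-1})$ and $\delta_{b,i}=\max_{c\in[C]} f(b^{i-1}|b^{i-1}_k=c)-f(b^{i-1})$. If $\delta_{a,i}\ge\delta_{b,i}$: let $c'$ be the maximal $c\in[C]$ attaining the maximum in $\delta_{a,i}$; set $a^i=(a^{i-1}|a^{i-1}_k=c')$, $b^i=b^{i-1}$, and then $a^{i+1}=a^i$, $b^{i+1}=(b^i|b^i_k=c')$.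 Otherwise: let $c'$ be the minimal $c\in[C]$ attaining the maximum in $\delta_{b,i}$; set $a^i=a^{i-1}$, $b^i=(b^{i-1}|b^{i-1}_k=c')$, and then $b^{i+1}=b^i$, $a^{i+1}=(a^i|a^i_k=c')$. Then increase $i$ by $2$. After the loop, return $a^{2n}$. *)

theory Defs
  imports Complex_Main
begin

section \<open>Submodular functions on the lattice $[C]^n$\<close>

text \<open>Vectors are lists of length \<open>n\<close>; coordinates are numbered \<open>0, \<dots>, n - 1\<close>, and
  \<open>x[k := c]\<close> is $(x|x_k=c)$.\<close>

definition box :: "nat \<Rightarrow> nat \<Rightarrow> nat list set" where
  "box C n = {x. length x = n \<and> (\<forall>k<n. x ! k \<le> C)}"

definition join :: "nat list \<Rightarrow> nat list \<Rightarrow> nat list" where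
  "join x y = map2 max x y"

definition meet :: "nat list \<Rightarrow> nat list \<Rightarrow> nat list" where
  "meet x y = map2 min x y"

definition submodular :: "nat \<Rightarrow> nat \<Rightarrow> (nat list \<Rightarrow> real) \<Rightarrow> bool" where
  "submodular C n f \<longleftrightarrow>
     (\<forall>x\<in>box C n. \<forall>y\<in>box C n. f x + f y \<ge> f (join x y) + f (meet x y))"

section \<open>The Generalized Double Greedy algorithm\<close>

definition gain :: "(nat list \<Rightarrow> real) \<Rightarrow> nat \<Rightarrow> nat \<Rightarrow> nat list \<Rightarrow> real" where
  "gain f C k x = Max ((\<lambda>c. f (x[k := c])) ` {0..C}) - f x"

definition maximizers :: "(nat list \<Rightarrow> real) \<Rightarrow> nat \<Rightarrow> nat \<Rightarrow> nat list \<Rightarrow> nat set" where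
  "maximizers f C k x = {c \<in> {0..C}. f (x[k := c]) = Max ((\<lambda>d. f (x[k := d])) ` {0..C})}"

text \<open>One pass through the loop body maps $(a^{i-1},b^{i-1})$ to $(a^{i+1},b^{i+1})$; the
  primed pair is $(a^i,b^i)$.\<close>

definition greedy_round ::
  "(nat list \<Rightarrow> real) \<Rightarrow> nat \<Rightarrow> nat \<Rightarrow> nat list \<times> nat list \<Rightarrow> nat list \<times> nat list" where
  "greedy_round f C k = (\<lambda>(a, b).
     if gain f C k a \<ge> gain f C k b then
       let c' = Max (maximizers f C k a);
           a' = a[k := c']; b' = b
       in (a', b'[k := c'])
     else
       let c' = Min (maximizers f C k b);
           a' = a; b' = b[k := c']
       in (a'[k := c'], b'))"

text \<open>\<open>greedy_state f C n k\<close> is $(a^{2k},b^{2k})$.\<close>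

primrec greedy_state ::
  "(nat list \<Rightarrow> real) \<Rightarrow> nat \<Rightarrow> nat \<Rightarrow> nat \<Rightarrow> nat list \<times> nat list" where
  "greedy_state f C n 0 = (replicate n 0, replicate n C)"
| "greedy_state f C n (Suc k) = greedy_round f C k (greedy_state f C n k)"

definition double_greedy :: "(nat list \<Rightarrow> real) \<Rightarrow> nat \<Rightarrow> nat \<Rightarrow> nat list" where
  "double_greedy f C n = fst (greedy_state f C n n)"

section \<open>A unit-cost machine with a value oracle\<close>

text \<open>Running time is measured on a random-access machine with natural-number registers, real
  registers and arrays of natural numbers. A program is a syntactic object that can reach the
  function only through \<open>Query\<close>, which passes an array by reference and costs \<open>T\<close>. All other
  instructions take unit time, except that allocating an array is also charged its length, and
  every iteration of a loop is charged one unit besides the cost of its body.\<close>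

datatype operand = Lit nat | Reg string

datatype com =
    Set string operand                  (* x := v *)
  | Add string operand operand          (* x := v + w *)
  | RMove string string                 (* r := r1 *)
  | RSub string string string           (* r := r1 - r2 *)
  | Alloc string operand operand        (* X := new array of length v, all entries w *)
  | Write string operand operand        (* X[v] := w *)
  | Query string string                 (* r := f(X) *)
  | Seq com com  (infixr ";;" 60)
  | IfLe string string com com          (* if r1 <= r2 then .. else .. *)
  | IfLess string string com com        (* if r1 < r2 then .. else .. *)
  | Skip
  | For string operand com              (* for x = 0, ..., v - 1 do .. *)

record store =
  nreg :: "string \<Rightarrow> nat"
  rreg :: "string \<Rightarrow> real"
  arr :: "string \<Rightarrow> nat list"

primrec val :: "operand \<Rightarrow> store \<Rightarrow> nat" where
  "val (Lit m) s = m"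
| "val (Reg x) s = nreg s x"

definition set_nreg :: "string \<Rightarrow> nat \<Rightarrow> store \<Rightarrow> store" where
  "set_nreg x m s = s\<lparr>nreg := (nreg s)(x := m)\<rparr>"

definition set_rreg :: "string \<Rightarrow> real \<Rightarrow> store \<Rightarrow> store" where
  "set_rreg r u s = s\<lparr>rreg := (rreg s)(r := u)\<rparr>"

definition set_arr :: "string \<Rightarrow> nat list \<Rightarrow> store \<Rightarrow> store" where
  "set_arr X xs s = s\<lparr>arr := (arr s)(X := xs)\<rparr>"

text \<open>\<open>exec f T p s\<close> is the final store together with the time used. The bound of a loop is
  evaluated once, on entry.\<close>

primrec exec :: "(nat list \<Rightarrow> real) \<Rightarrow> nat \<Rightarrow> com \<Rightarrow> store \<Rightarrow> store \<times> nat" where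
  "exec f T (Set x v) = (\<lambda>s. (set_nreg x (val v s) s, 1))"
| "exec f T (Add x v w) = (\<lambda>s. (set_nreg x (val v s + val w s) s, 1))"
| "exec f T (RMove r r1) = (\<lambda>s. (set_rreg r (rreg s r1) s, 1))"
| "exec f T (RSub r r1 r2) = (\<lambda>s. (set_rreg r (rreg s r1 - rreg s r2) s, 1))"
| "exec f T (Alloc X v w) =
     (\<lambda>s. (set_arr X (replicate (val v s) (val w s)) s, 1 + val v s))"
| "exec f T (Write X v w) = (\<lambda>s. (set_arr X ((arr s X)[val v s := val w s]) s, 1))"
| "exec f T (Query r X) = (\<lambda>s. (set_rreg r (f (arr s X)) s, T))"
| "exec f T (p ;; q) =
     (\<lambda>s. let (s1, t1) = exec f T p s; (s2, t2) = exec f T q s1 in (s2, t1 + t2))"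
| "exec f T (IfLe r1 r2 p q) =
     (\<lambda>s. let (s', t) = (if rreg s r1 \<le> rreg s r2 then exec f T p s else exec f T q s)
          in (s', 1 + t))"
| "exec f T (IfLess r1 r2 p q) =
     (\<lambda>s. let (s', t) = (if rreg s r1 < rreg s r2 then exec f T p s else exec f T q s)
          in (s', 1 + t))"
| "exec f T Skip = (\<lambda>s. (s, 1))"
| "exec f T (For x v p) =
     (\<lambda>s. fold (\<lambda>j (s1, t1). let (s2, t2) = exec f T p (set_nreg x j s1) in (s2, t1 + 1 + t2))
           [0..<val v s] (s, 1))"

section \<open>The algorithm as a machine program\<close>

text \<open>Scanning the candidate values in increasing order with a non-strict comparison finds the
  maximal maximizer, with a strict one the minimal maximizer. The scans overwrite entry \<open>k\<close> of
  both arrays; it is set to its new value at the end of the round, which in either case is the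
  same for both.\<close>

definition scan_a :: com where
  "scan_a =
     Query ''fa'' ''a'' ;;
     Write ''a'' (Reg ''k'') (Lit 0) ;;
     Query ''best_a'' ''a'' ;;
     Set ''ca'' (Lit 0) ;;
     For ''c'' (Reg ''m'')
       (Write ''a'' (Reg ''k'') (Reg ''c'') ;;
        Query ''v'' ''a'' ;;
        IfLe ''best_a'' ''v'' (RMove ''best_a'' ''v'' ;; Set ''ca'' (Reg ''c'')) Skip) ;;
     RSub ''delta_a'' ''best_a'' ''fa''"

definition scan_b :: com where
  "scan_b =
     Query ''fb'' ''b'' ;;
     Write ''b'' (Reg ''k'') (Lit 0) ;;
     Query ''best_b'' ''b'' ;;
     Set ''cb'' (Lit 0) ;;
     For ''c'' (Reg ''m'')
       (Write ''b'' (Reg ''k'') (Reg ''c'') ;;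
        Query ''v'' ''b'' ;;
        IfLess ''best_b'' ''v'' (RMove ''best_b'' ''v'' ;; Set ''cb'' (Reg ''c'')) Skip) ;;
     RSub ''delta_b'' ''best_b'' ''fb''"

definition double_greedy_program :: com where
  "double_greedy_program =
     Alloc ''a'' (Reg ''n'') (Lit 0) ;;
     Alloc ''b'' (Reg ''n'') (Reg ''C'') ;;
     Add ''m'' (Reg ''C'') (Lit 1) ;;
     For ''k'' (Reg ''n'')
       (scan_a ;;
        scan_b ;;
        IfLe ''delta_b'' ''delta_a''
          (Write ''a'' (Reg ''k'') (Reg ''ca'') ;; Write ''b'' (Reg ''k'') (Reg ''ca''))
          (Write ''b'' (Reg ''k'') (Reg ''cb'') ;; Write ''a'' (Reg ''k'') (Reg ''cb'')))"

definition input_store :: "nat \<Rightarrow> nat \<Rightarrow> store" where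
  "input_store C n =
     \<lparr>nreg = (\<lambda>_. 0)(''C'' := C, ''n'' := n), rreg = (\<lambda>_. 0), arr = (\<lambda>_. [])\<rparr>"

definition program_output :: "(nat list \<Rightarrow> real) \<Rightarrow> nat \<Rightarrow> nat \<Rightarrow> nat \<Rightarrow> nat list" where
  "program_output f T C n = arr (fst (exec f T double_greedy_program (input_store C n))) ''a''"

definition running_time :: "(nat list \<Rightarrow> real) \<Rightarrow> nat \<Rightarrow> nat \<Rightarrow> nat \<Rightarrow> nat" where
  "running_time f T C n = snd (exec f T double_greedy_program (input_store C n))"

end

theory Submission
  imports Defs
begin

text \<open>Let $o$ be a maximizer, and let $o^k$ agree with the arrays \<open>a\<close>, \<open>b\<close> on the coordinates
  fixed in the first $k$ rounds and with $o$ on the others, so that $a \le o^k \le b$. By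
  submodularity, the increments of $f$ in coordinate $k$ decrease from $a$ to $o^k$ to $b$. This
  implies that in each round the loss $f(o^k) - f(o^{k+1})$ is at most the total gain of
  $f(a) + f(b)$. Since all three vectors are equal at the end and $f$ is nonnegative at the start,
  summing up gives $f(o) - f(a^{2n}) \le 2 f(a^{2n})$.\<close>

section \<open>The approximation guarantee\<close>

lemma mem_box_iff: "x \<in> box C n \<longleftrightarrow> length x = n \<and> (\<forall>c\<in>set x. c \<le> C)"
  by (auto simp: box_def all_set_conv_all_nth)

lemma finite_box: "finite (box C n)"
proof -
  have "box C n = {x. set x \<subseteq> {..C} \<and> length x = n}"
    by (auto simp: mem_box_iff)
  then show ?thesis
    by (simp add: finite_lists_length_eq)
qed

lemma map2_max_eq_right: "list_all2 (\<le>) xs ys \<Longrightarrow> map2 max xs ys = (ys :: 'a::linorder list)"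
  by (induction rule: list_all2_induct) auto

lemma map2_min_eq_left: "list_all2 (\<le>) xs ys \<Longrightarrow> map2 min xs ys = (xs :: 'a::linorder list)"
  by (induction rule: list_all2_induct) auto

text \<open>Diminishing returns. The join of \<open>p @ d # xs\<close> and \<open>p @ c # ys\<close>
  is \<open>p @ d # ys\<close> and their meet is \<open>p @ c # xs\<close>, so this is the
  submodular inequality for that pair, rearranged.\<close>

lemma submodular_coordinate:
  assumes sub: "submodular C n f"
    and x: "p @ d # xs \<in> box C n" and y: "p @ c # ys \<in> box C n"
    and le: "list_all2 (\<le>) xs ys" and cd: "c \<le> d"
  shows "f (p @ d # ys) - f (p @ c # ys) \<le> f (p @ d # xs) - f (p @ c # xs)"
proof -
  have "join (p @ d # xs) (p @ c # ys) = p @ d # ys"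
    using map2_max_eq_right[OF le] cd by (simp add: join_def zip_same_conv_map map_idI)
  moreover have "meet (p @ d # xs) (p @ c # ys) = p @ c # xs"
    using map2_min_eq_left[OF le] cd by (simp add: meet_def zip_same_conv_map map_idI)
  ultimately show ?thesis
    using sub x y unfolding submodular_def by force
qed

section \<open>One round of the algorithm and the accounting over all rounds\<close>

lemma maximizersD:
  assumes "c \<in> maximizers f C k x"
  shows "c \<le> C" "\<And>d. d \<le> C \<Longrightarrow> f (x[k := d]) \<le> f (x[k := c])"
    "gain f C k x = f (x[k := c]) - f x"
  using assms by (auto simp: maximizers_def gain_def)

lemma finite_maximizers: "finite (maximizers f C k x)"
  by (simp add: maximizers_def)

lemma maximizers_nonempty: "maximizers f C k x \<noteq> {}"
proof -
  have "Max ((\<lambda>d. f (x[k := d])) ` {0..C}) \<in> (\<lambda>d. f (x[k := d])) ` {0..C}"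
    by (rule Max_in) auto
  then obtain d where "d \<le> C" "f (x[k := d]) = Max ((\<lambda>d. f (x[k := d])) ` {0..C})"
    by fastforce
  then have "d \<in> maximizers f C k x"
    by (simp add: maximizers_def)
  then show ?thesis
    by blast
qed

text \<open>Both branches finish by writing one value into both arrays, so a round has a single
  shape. The disjunction keeps what the accounting uses: the value attains the larger of the two
  gains.\<close>

lemma greedy_round_eq:
  obtains c where "greedy_round f C k (a, b) = (a[k := c], b[k := c])" "c \<le> C"
    "(c \<in> maximizers f C k a \<and> gain f C k b \<le> gain f C k a) \<or>
     (c \<in> maximizers f C k b \<and> gain f C k a \<le> gain f C k b)"
proof (cases "gain f C k b \<le> gain f C k a")
  case True
  have "Max (maximizers f C k a) \<in> maximizers f C k a"
    by (rule Max_in[OF finite_maximizers maximizers_nonempty])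
  with True show ?thesis
    by (intro that[of "Max (maximizers f C k a)"])
      (auto simp: greedy_round_def Let_def dest: maximizersD)
next
  case False
  have "Min (maximizers f C k b) \<in> maximizers f C k b"
    by (rule Min_in[OF finite_maximizers maximizers_nonempty])
  with False show ?thesis
    by (intro that[of "Min (maximizers f C k b)"])
      (auto simp: greedy_round_def Let_def dest: maximizersD)
qed

text \<open>The prefix \<open>p\<close> holds the values fixed so far and
  \<open>p @ drop k x\<close> is the hybrid vector $o^k$, here for an arbitrary \<open>x\<close> of
  the box. The inequality is the telescoped sum of the losses of the single rounds.\<close>

lemma greedy_state_invariant:
  assumes sub: "submodular C n f" and opt: "x \<in> box C n" and "k \<le> n"
  shows "\<exists>p \<in> box C k.
    greedy_state f C n k = (p @ replicate (n - k) 0, p @ replicate (n - k) C) \<and>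
    f x - f (p @ drop k x) \<le>
      (f (p @ replicate (n - k) 0) - f (replicate n 0)) +
      (f (p @ replicate (n - k) C) - f (replicate n C))"
  using \<open>k \<le> n\<close>
proof (induction k)
  case 0
  then show ?case
    by (auto simp: mem_box_iff)
next
  case (Suc k)
  define zs where "zs = replicate (n - Suc k) (0::nat)"
  define ms where "ms = replicate (n - Suc k) C"
  define xs where "xs = drop (Suc k) x"
  from Suc obtain p where p: "p \<in> box C k"
    and state: "greedy_state f C n k = (p @ replicate (n - k) 0, p @ replicate (n - k) C)"
    and bound: "f x - f (p @ drop k x) \<le>
      (f (p @ replicate (n - k) 0) - f (replicate n 0)) +
      (f (p @ replicate (n - k) C) - f (replicate n C))"
    by auto
  have split: "replicate (n - k) d = d # replicate (n - Suc k) d" for d :: nat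
    using \<open>Suc k \<le> n\<close> by (metis Suc_diff_le diff_Suc_Suc replicate_Suc)
  have len: "length x = n" "length p = k"
    using opt p by (auto simp: mem_box_iff)
  have dropx: "drop k x = x ! k # xs"
    using \<open>Suc k \<le> n\<close> len by (simp add: xs_def Cons_nth_drop_Suc)
  have upd: "(p @ e # ys)[k := d] = p @ d # ys" for d e and ys :: "nat list"
    using list_update_length[of p e ys d] len by simp
  \<comment> \<open>These are the restrictions of \<open>f\<close> to coordinate \<open>k\<close>,
    taken through the lower array, the upper array and the hybrid vector. The rest of the induction
    step only compares these three functions on {0..C}.\<close>
  define A where "A c = f (p @ c # zs)" for c
  define B where "B c = f (p @ c # ms)" for c
  define O' where "O' c = f (p @ c # xs)" for c
  have xk: "x ! k \<le> C" and xs_le: "\<forall>c\<in>set xs. c \<le> C"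
    using opt \<open>Suc k \<le> n\<close> by (auto simp: mem_box_iff xs_def dest: in_set_dropD)
  have in_box: "p @ c # zs \<in> box C n" "p @ c # xs \<in> box C n" "p @ c # ms \<in> box C n" if "c \<le> C" for c
    using p that xs_le len \<open>Suc k \<le> n\<close> by (auto simp: mem_box_iff zs_def ms_def xs_def)
  have le1: "list_all2 (\<le>) zs xs" and le2: "list_all2 (\<le>) xs ms"
    using opt len by (auto simp: box_def list_all2_conv_all_nth zs_def ms_def xs_def)
  then have le3: "list_all2 (\<le>) zs ms"
    by (auto simp: list_all2_conv_all_nth zs_def ms_def)
  \<comment> \<open>The tails satisfy \<open>zs\<close> \<le> \<open>xs\<close> \<le>
    \<open>ms\<close>, so increments shrink from \<open>A\<close> to \<open>O'\<close> to
    \<open>B\<close>.\<close>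
  have AO: "O' d - O' c \<le> A d - A c" and OB: "B d - B c \<le> O' d - O' c"
    and AB: "B d - B c \<le> A d - A c"
    if "c \<le> d" "d \<le> C" for c d
    using submodular_coordinate[OF sub _ _ le1] submodular_coordinate[OF sub _ _ le2]
      submodular_coordinate[OF sub _ _ le3] in_box that
    by (auto simp: A_def B_def O'_def)
  define a where "a = p @ 0 # zs"
  define b where "b = p @ C # ms"
  have a_upd: "f (a[k := c]) = A c" and b_upd: "f (b[k := c]) = B c" for c
    by (simp_all add: a_def b_def A_def B_def upd)
  have fa: "f a = A 0" and fb: "f b = B C"
    by (simp_all add: a_def b_def A_def B_def)
  obtain c where c: "greedy_round f C k (a, b) = (a[k := c], b[k := c])" "c \<le> C"
    "(c \<in> maximizers f C k a \<and> gain f C k b \<le> gain f C k a) \<or>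
     (c \<in> maximizers f C k b \<and> gain f C k a \<le> gain f C k b)"
    by (rule greedy_round_eq)
  have gain_a: "A d - A 0 \<le> gain f C k a" and gain_b: "B d - B C \<le> gain f C k b" if "d \<le> C" for d
    using that by (auto simp: gain_def a_upd b_upd fa fb)
  have step: "O' (x ! k) - O' c \<le> (A c - A 0) + (B c - B C)"
    using c(3)
  proof
    \<comment> \<open>If \<open>x ! k\<close> > \<open>c\<close>, the change of \<open>O'\<close> is
      at most \<open>A (x ! k) - A c\<close>, hence not positive, and neither array loses value. If
      \<open>x ! k\<close> \<le> \<open>c\<close>, it is at most \<open>B (x ! k) - B c\<close>,
      which splits into \<open>B (x ! k) - B C\<close>, bounded by the larger gain
      \<open>A c - A 0\<close>, and \<open>B C - B c\<close>, which is at most 0.\<close>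
    assume *: "c \<in> maximizers f C k a \<and> gain f C k b \<le> gain f C k a"
    then have max: "A d \<le> A c" if "d \<le> C" for d
      using that maximizersD(2)[of c f C k a d] by (simp add: a_upd)
    have "gain f C k a = A c - A 0"
      using * maximizersD(3)[of c f C k a] by (simp add: a_upd fa)
    \<comment> \<open>Lowering the upper array costs nothing: going from \<open>c\<close> to
      \<open>C\<close> does not raise \<open>A\<close>, hence does not raise
      \<open>B\<close>.\<close>
    moreover have "B C \<le> B c"
      using AB[of c C] max[of C] \<open>c \<le> C\<close> by simp
    ultimately show ?thesis
      using * AO[of c "x ! k"] OB[of "x ! k" c] max[of 0] max[of "x ! k"] gain_b[of "x ! k"] xk
        \<open>c \<le> C\<close> by (cases "x ! k \<le> c") auto
  next
    \<comment> \<open>The mirror image: now \<open>x ! k\<close> \<le> \<open>c\<close> is the case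
      without loss, and for \<open>x ! k\<close> > \<open>c\<close> the gain
      \<open>B c - B C\<close> pays for \<open>A (x ! k) - A 0\<close>.\<close>
    assume *: "c \<in> maximizers f C k b \<and> gain f C k a \<le> gain f C k b"
    then have max: "B d \<le> B c" if "d \<le> C" for d
      using that maximizersD(2)[of c f C k b d] by (simp add: b_upd)
    have "gain f C k b = B c - B C"
      using * maximizersD(3)[of c f C k b] by (simp add: b_upd fb)
    moreover have "A 0 \<le> A c"
      using AB[of 0 c] max[of 0] \<open>c \<le> C\<close> by simp
    ultimately show ?thesis
      using * AO[of c "x ! k"] OB[of "x ! k" c] max[of C] max[of "x ! k"] gain_a[of "x ! k"] xk
        \<open>c \<le> C\<close> by (cases "x ! k \<le> c") auto
  qed
  have "greedy_state f C n (Suc k) = ((p @ [c]) @ zs, (p @ [c]) @ ms)"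
    using c(1) state by (simp add: split a_def b_def zs_def ms_def upd)
  moreover have "p @ [c] \<in> box C (Suc k)"
    using p \<open>c \<le> C\<close> by (auto simp: mem_box_iff)
  moreover have "f x - f ((p @ [c]) @ xs) \<le>
      (f ((p @ [c]) @ zs) - f (replicate n 0)) + (f ((p @ [c]) @ ms) - f (replicate n C))"
    using bound step unfolding split dropx
    by (simp add: A_def B_def O'_def zs_def ms_def)
  ultimately show ?case
    unfolding zs_def ms_def xs_def by blast
qed

lemma double_greedy_approx:
  assumes "submodular C n f" and nonneg: "\<forall>x\<in>box C n. f x \<ge> 0"
  shows "double_greedy f C n \<in> box C n"
    and "f (double_greedy f C n) \<ge> 1 / 3 * Max (f ` box C n)"
proof -
  have zero: "replicate n 0 \<in> box C n" and top: "replicate n C \<in> box C n"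
    by (auto simp: mem_box_iff)
  \<comment> \<open>Keeping \<open>x\<close> arbitrary serves two instances: the zero vector gives
    membership in the box, a maximizer gives the ratio.\<close>
  have *: "double_greedy f C n \<in> box C n \<and> f x \<le> 3 * f (double_greedy f C n)"
    if x: "x \<in> box C n" for x
  proof -
    obtain p where "p \<in> box C n" and state: "greedy_state f C n n = (p, p)"
      and "f x - f (p @ drop n x) \<le> (f p - f (replicate n 0)) + (f p - f (replicate n C))"
      using greedy_state_invariant[OF assms(1) x order_refl] by auto
    moreover have "drop n x = []"
      using x by (simp add: mem_box_iff)
    moreover have "0 \<le> f (replicate n 0)" "0 \<le> f (replicate n C)"
      using nonneg zero top by auto
    ultimately show ?thesis
      by (simp add: double_greedy_def)
  qed
  show "double_greedy f C n \<in> box C n"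
    using *[OF zero] by simp
  have "Max (f ` box C n) \<in> f ` box C n"
    using zero finite_box by (intro Max_in) auto
  then obtain x where "x \<in> box C n" "Max (f ` box C n) = f x"
    by blast
  with *[of x] show "f (double_greedy f C n) \<ge> 1 / 3 * Max (f ` box C n)"
    by simp
qed

section \<open>The machine program\<close>

text \<open>Induction over the partial folds on \<open>[0..<j]\<close>. The invariant describes the
  store before the counter is set to \<open>j\<close>. The leading 1 is charged on entry, and
  \<open>B + 1\<close> is the body plus the unit charged per iteration.\<close>

lemma exec_For_invariant:
  assumes N: "val v s = N" and "I 0 s"
    and step: "\<And>j s. j < N \<Longrightarrow> I j s \<Longrightarrow>
      I (Suc j) (fst (exec f T p (set_nreg x j s))) \<and> snd (exec f T p (set_nreg x j s)) \<le> B"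
  shows "I N (fst (exec f T (For x v p) s))"
    and "snd (exec f T (For x v p) s) \<le> 1 + N * (B + 1)"
proof -
  define F where "F = (\<lambda>j (s1, t1). let (s2, t2) = exec f T p (set_nreg x j s1) in (s2, t1 + 1 + t2))"
  have "I j (fst (fold F [0..<j] (s, 1))) \<and> snd (fold F [0..<j] (s, 1)) \<le> 1 + j * (B + 1)"
    if "j \<le> N" for j
    using that
  proof (induction j)
    case 0
    then show ?case using \<open>I 0 s\<close> by simp
  next
    case (Suc j)
    obtain s1 t1 where eq: "fold F [0..<j] (s, 1) = (s1, t1)"
      by fastforce
    have "I j s1" "t1 \<le> 1 + j * (B + 1)"
      using Suc eq by auto
    moreover have "fold F [0..<Suc j] (s, 1) = F j (s1, t1)"
      using eq by simp
    ultimately show ?case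
      using step[of j s1] Suc(2) by (simp only:) (simp add: F_def split_beta)
  qed
  from this[of N] show "I N (fst (exec f T (For x v p) s))"
    and "snd (exec f T (For x v p) s) \<le> 1 + N * (B + 1)"
    by (simp_all add: F_def N)
qed

text \<open>The hypotheses are what a completed scan knows about its stored index: no value is
  better, and every tie lies at or below it.\<close>

lemma Max_maximizers_eq:
  assumes "c \<le> C"
    and "\<forall>d\<le>C. f (x[k := d]) \<le> f (x[k := c]) \<and> (f (x[k := d]) = f (x[k := c]) \<longrightarrow> d \<le> c)"
  shows "Max (maximizers f C k x) = c" "gain f C k x = f (x[k := c]) - f x"
proof -
  have eq: "Max ((\<lambda>d. f (x[k := d])) ` {0..C}) = f (x[k := c])"
    using assms by (intro Max_eqI) auto
  then show "gain f C k x = f (x[k := c]) - f x"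
    by (simp add: gain_def)
  show "Max (maximizers f C k x) = c"
    using assms eq by (intro Max_eqI) (auto simp: maximizers_def)
qed

lemma Min_maximizers_eq:
  assumes "c \<le> C"
    and "\<forall>d\<le>C. f (x[k := d]) \<le> f (x[k := c]) \<and> (f (x[k := d]) = f (x[k := c]) \<longrightarrow> c \<le> d)"
  shows "Min (maximizers f C k x) = c" "gain f C k x = f (x[k := c]) - f x"
proof -
  have eq: "Max ((\<lambda>d. f (x[k := d])) ` {0..C}) = f (x[k := c])"
    using assms by (intro Max_eqI) auto
  then show "gain f C k x = f (x[k := c]) - f x"
    by (simp add: gain_def)
  show "Min (maximizers f C k x) = c"
    using assms eq by (intro Min_eqI) (auto simp: maximizers_def)
qed

section \<open>Correctness and cost of the two scans\<close>

lemmas exec_defs = set_nreg_def set_rreg_def set_arr_def split_beta Let_def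

text \<open>Separate rules for store and time allow a program to be cut at any \<open>;;\<close>
  while its pieces stay folded.\<close>

lemma exec_Seq:
  "fst (exec f T (p ;; q) s) = fst (exec f T q (fst (exec f T p s)))"
  "snd (exec f T (p ;; q) s) = snd (exec f T p s) + snd (exec f T q (fst (exec f T p s)))"
  by (simp_all add: split_beta Let_def)

text \<open>The scan spoils entry \<open>k\<close> of the array, hence the unspecified
  \<open>d\<close>. This does not disturb later evaluations, since a second update of entry
  \<open>k\<close> overrides the first. The cost is 2 * T + 2 before the loop, 1 + Suc C * (T + 5)
  for the loop and 1 for the subtraction.\<close>

lemma exec_scan_a:
  fixes f :: "nat list \<Rightarrow> real" and T :: nat
  assumes k: "nreg s ''k'' = k" and m: "nreg s ''m'' = Suc C" and a: "arr s ''a'' = a"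
  defines "s' \<equiv> fst (exec f T scan_a s)"
  shows "nreg s' ''k'' = k" "nreg s' ''m'' = Suc C" "arr s' ''b'' = arr s ''b''"
    and "\<exists>d. arr s' ''a'' = a[k := d]"
    and "rreg s' ''delta_a'' = gain f C k a"
    and "nreg s' ''ca'' = Max (maximizers f C k a)"
    and "snd (exec f T scan_a s) \<le> 2 * T + 4 + Suc C * (T + 5)"
proof -
  define g where "g d = f (a[k := d])" for d
  define pre where "pre = (Query ''fa'' ''a'' ;; Write ''a'' (Reg ''k'') (Lit 0) ;;
     Query ''best_a'' ''a'' ;; Set ''ca'' (Lit 0))"
  define body where "body = (Write ''a'' (Reg ''k'') (Reg ''c'') ;; Query ''v'' ''a'' ;;
        IfLe ''best_a'' ''v'' (RMove ''best_a'' ''v'' ;; Set ''ca'' (Reg ''c'')) Skip)"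
  define loop where "loop = For ''c'' (Reg ''m'') body"
  \<comment> \<open>Here \<open>j - 1\<close> is truncated, so before the first iteration it forces
    index 0, the value already queried; after \<open>Suc C\<close> iterations it gives the bound
    \<open>C\<close>. The non-strict test moves the index on every tie, so ties lie at or below
    it.\<close>
  define I where "I j u \<longleftrightarrow> nreg u ''k'' = k \<and> nreg u ''m'' = Suc C \<and> arr u ''b'' = arr s ''b'' \<and>
      (\<exists>d. arr u ''a'' = a[k := d]) \<and> rreg u ''fa'' = f a \<and>
      rreg u ''best_a'' = g (nreg u ''ca'') \<and> nreg u ''ca'' \<le> j - 1 \<and>
      (\<forall>d<j. g d \<le> g (nreg u ''ca'') \<and> (g d = g (nreg u ''ca'') \<longrightarrow> d \<le> nreg u ''ca''))" for j and u :: store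
  define s1 where "s1 = fst (exec f T pre s)"
  define s2 where "s2 = fst (exec f T loop s1)"
  have fst_scan: "s' = fst (exec f T (RSub ''delta_a'' ''best_a'' ''fa'') s2)"
    and snd_scan: "snd (exec f T scan_a s) = snd (exec f T pre s) + snd (exec f T loop s1) + 1"
    by (simp_all add: s'_def scan_a_def pre_def loop_def body_def s1_def s2_def exec_Seq
        del: exec.simps(8) exec.simps(12))
  have I0: "I 0 s1" and m1: "nreg s1 ''m'' = Suc C"
    using k m a by (auto simp: I_def s1_def pre_def exec_defs g_def)
  have t1: "snd (exec f T pre s) = 2 * T + 2"
    by (simp add: pre_def exec_defs)
  have step: "I (Suc j) (fst (exec f T body (set_nreg ''c'' j u))) \<and>
      snd (exec f T body (set_nreg ''c'' j u)) \<le> T + 4"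
    if u: "I j u" for j u
  proof -
    obtain d where "arr u ''a'' = a[k := d]"
      using u by (auto simp: I_def)
    then show ?thesis
      using u by (auto simp: I_def body_def exec_defs g_def less_Suc_eq)
  qed
  have loop: "I (Suc C) s2" "snd (exec f T loop s1) \<le> 1 + Suc C * (T + 5)"
    using exec_For_invariant[of "Reg ''m''" s1 "Suc C" I f T body "''c''" "T + 4"] I0 step
    by (simp_all add: m1 loop_def s2_def algebra_simps del: exec.simps(12))
  show "snd (exec f T scan_a s) \<le> 2 * T + 4 + Suc C * (T + 5)"
    using loop(2) unfolding snd_scan t1 by simp
  have *: "nreg s2 ''ca'' \<le> C"
    "\<forall>d\<le>C. f (a[k := d]) \<le> f (a[k := nreg s2 ''ca'']) \<and>
       (f (a[k := d]) = f (a[k := nreg s2 ''ca'']) \<longrightarrow> d \<le> nreg s2 ''ca'')"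
    using loop(1) by (auto simp: I_def g_def less_Suc_eq_le)
  show "nreg s' ''k'' = k" "nreg s' ''m'' = Suc C" "arr s' ''b'' = arr s ''b''"
    "\<exists>d. arr s' ''a'' = a[k := d]" "rreg s' ''delta_a'' = gain f C k a"
    "nreg s' ''ca'' = Max (maximizers f C k a)"
    using loop(1) Max_maximizers_eq[OF *]
    by (simp_all add: fst_scan I_def exec_defs g_def)
qed

text \<open>As for the other array, but \<open>ca\<close> and \<open>delta_a\<close> must also
  survive, because the final comparison of the round reads them after this scan.\<close>

lemma exec_scan_b:
  fixes f :: "nat list \<Rightarrow> real" and T :: nat
  assumes k: "nreg s ''k'' = k" and m: "nreg s ''m'' = Suc C" and b: "arr s ''b'' = b"
  defines "s' \<equiv> fst (exec f T scan_b s)"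
  shows "nreg s' ''k'' = k" "nreg s' ''m'' = Suc C" "arr s' ''a'' = arr s ''a''"
    and "nreg s' ''ca'' = nreg s ''ca''" "rreg s' ''delta_a'' = rreg s ''delta_a''"
    and "\<exists>d. arr s' ''b'' = b[k := d]"
    and "rreg s' ''delta_b'' = gain f C k b"
    and "nreg s' ''cb'' = Min (maximizers f C k b)"
    and "snd (exec f T scan_b s) \<le> 2 * T + 4 + Suc C * (T + 5)"
proof -
  define g where "g d = f (b[k := d])" for d
  define pre where "pre = (Query ''fb'' ''b'' ;; Write ''b'' (Reg ''k'') (Lit 0) ;;
     Query ''best_b'' ''b'' ;; Set ''cb'' (Lit 0))"
  define body where "body = (Write ''b'' (Reg ''k'') (Reg ''c'') ;; Query ''v'' ''b'' ;;
        IfLess ''best_b'' ''v'' (RMove ''best_b'' ''v'' ;; Set ''cb'' (Reg ''c'')) Skip)"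
  define loop where "loop = For ''c'' (Reg ''m'') body"
  \<comment> \<open>The strict test keeps the earliest maximizer, so ties lie at or above the stored
    index.\<close>
  define I where "I j u \<longleftrightarrow> nreg u ''k'' = k \<and> nreg u ''m'' = Suc C \<and> arr u ''a'' = arr s ''a'' \<and>
      nreg u ''ca'' = nreg s ''ca'' \<and> rreg u ''delta_a'' = rreg s ''delta_a'' \<and>
      (\<exists>d. arr u ''b'' = b[k := d]) \<and> rreg u ''fb'' = f b \<and>
      rreg u ''best_b'' = g (nreg u ''cb'') \<and> nreg u ''cb'' \<le> j - 1 \<and>
      (\<forall>d<j. g d \<le> g (nreg u ''cb'') \<and> (g d = g (nreg u ''cb'') \<longrightarrow> nreg u ''cb'' \<le> d))" for j and u :: store
  define s1 where "s1 = fst (exec f T pre s)"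
  define s2 where "s2 = fst (exec f T loop s1)"
  have fst_scan: "s' = fst (exec f T (RSub ''delta_b'' ''best_b'' ''fb'') s2)"
    and snd_scan: "snd (exec f T scan_b s) = snd (exec f T pre s) + snd (exec f T loop s1) + 1"
    by (simp_all add: s'_def scan_b_def pre_def loop_def body_def s1_def s2_def exec_Seq
        del: exec.simps(8) exec.simps(12))
  have I0: "I 0 s1" and m1: "nreg s1 ''m'' = Suc C"
    using k m b by (auto simp: I_def s1_def pre_def exec_defs g_def)
  have t1: "snd (exec f T pre s) = 2 * T + 2"
    by (simp add: pre_def exec_defs)
  have step: "I (Suc j) (fst (exec f T body (set_nreg ''c'' j u))) \<and>
      snd (exec f T body (set_nreg ''c'' j u)) \<le> T + 4"
    if u: "I j u" for j u
  proof -
    obtain d where "arr u ''b'' = b[k := d]"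
      using u by (auto simp: I_def)
    then show ?thesis
      using u by (auto simp: I_def body_def exec_defs g_def less_Suc_eq)
  qed
  have loop: "I (Suc C) s2" "snd (exec f T loop s1) \<le> 1 + Suc C * (T + 5)"
    using exec_For_invariant[of "Reg ''m''" s1 "Suc C" I f T body "''c''" "T + 4"] I0 step
    by (simp_all add: m1 loop_def s2_def algebra_simps del: exec.simps(12))
  show "snd (exec f T scan_b s) \<le> 2 * T + 4 + Suc C * (T + 5)"
    using loop(2) unfolding snd_scan t1 by simp
  have *: "nreg s2 ''cb'' \<le> C"
    "\<forall>d\<le>C. f (b[k := d]) \<le> f (b[k := nreg s2 ''cb'']) \<and>
       (f (b[k := d]) = f (b[k := nreg s2 ''cb'']) \<longrightarrow> nreg s2 ''cb'' \<le> d)"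
    using loop(1) by (auto simp: I_def g_def less_Suc_eq_le)
  show "nreg s' ''k'' = k" "nreg s' ''m'' = Suc C" "arr s' ''a'' = arr s ''a''"
    "nreg s' ''ca'' = nreg s ''ca''" "rreg s' ''delta_a'' = rreg s ''delta_a''"
    "\<exists>d. arr s' ''b'' = b[k := d]" "rreg s' ''delta_b'' = gain f C k b"
    "nreg s' ''cb'' = Min (maximizers f C k b)"
    using loop(1) Min_maximizers_eq[OF *]
    by (simp_all add: fst_scan I_def exec_defs g_def)
qed

section \<open>Rounds and the whole program\<close>

definition round_body :: com where
  "round_body =
     scan_a ;;
     scan_b ;;
     IfLe ''delta_b'' ''delta_a''
       (Write ''a'' (Reg ''k'') (Reg ''ca'') ;; Write ''b'' (Reg ''k'') (Reg ''ca''))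
       (Write ''b'' (Reg ''k'') (Reg ''cb'') ;; Write ''a'' (Reg ''k'') (Reg ''cb''))"

lemma exec_round_body:
  fixes f :: "nat list \<Rightarrow> real" and T :: nat
  assumes k: "nreg s ''k'' = k" and m: "nreg s ''m'' = Suc C"
  defines "s' \<equiv> fst (exec f T round_body s)"
  shows "nreg s' ''m'' = Suc C"
    and "(arr s' ''a'', arr s' ''b'') = greedy_round f C k (arr s ''a'', arr s ''b'')"
    and "snd (exec f T round_body s) \<le> 4 * T + 11 + 2 * (Suc C * (T + 5))"
proof -
  define s1 where "s1 = fst (exec f T scan_a s)"
  define s2 where "s2 = fst (exec f T scan_b s1)"
  define fin where "fin = IfLe ''delta_b'' ''delta_a''
       (Write ''a'' (Reg ''k'') (Reg ''ca'') ;; Write ''b'' (Reg ''k'') (Reg ''ca''))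
       (Write ''b'' (Reg ''k'') (Reg ''cb'') ;; Write ''a'' (Reg ''k'') (Reg ''cb''))"
  have fst_round: "s' = fst (exec f T fin s2)"
    and snd_round: "snd (exec f T round_body s) =
      snd (exec f T scan_a s) + snd (exec f T scan_b s1) + snd (exec f T fin s2)"
    by (simp_all add: s'_def round_body_def fin_def s1_def s2_def exec_Seq del: exec.simps)
  note A = exec_scan_a[OF k m refl, where f = f and T = T, folded s1_def]
  note B = exec_scan_b[OF A(1,2) A(3), where f = f and T = T, folded s2_def]
  \<comment> \<open>One unit for the test and two for the writes; with twice 2 * T + 4 from the
    scans this explains 4 * T + 11.\<close>
  have fin: "snd (exec f T fin s2) = 3"
    by (simp add: fin_def exec_defs)
  show "snd (exec f T round_body s) \<le> 4 * T + 11 + 2 * (Suc C * (T + 5))"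
    using A(7) B(9) unfolding snd_round fin by linarith
  show "nreg s' ''m'' = Suc C"
    using B(2) by (simp add: fst_round fin_def exec_defs)
  \<comment> \<open>The spoiled entries \<open>d\<close> and \<open>e\<close> vanish because both
    branches of \<open>fin\<close> overwrite entry \<open>k\<close> of both arrays.\<close>
  obtain d e where "arr s1 ''a'' = (arr s ''a'')[k := d]" "arr s2 ''b'' = (arr s ''b'')[k := e]"
    using A(4) B(6) by blast
  then show "(arr s' ''a'', arr s' ''b'') = greedy_round f C k (arr s ''a'', arr s ''b'')"
    using A B by (simp add: fst_round fin_def exec_defs greedy_round_def)
qed

lemma exec_double_greedy_program:
  "program_output f T C n = double_greedy f C n"
  "running_time f T C n \<le> 4 + 2 * n + n * (4 * T + 12 + 2 * (Suc C * (T + 5)))"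
proof -
  define pre where "pre = (Alloc ''a'' (Reg ''n'') (Lit 0) ;;
     Alloc ''b'' (Reg ''n'') (Reg ''C'') ;; Add ''m'' (Reg ''C'') (Lit 1))"
  define loop where "loop = For ''k'' (Reg ''n'') round_body"
  define s1 where "s1 = fst (exec f T pre (input_store C n))"
  define s2 where "s2 = fst (exec f T loop s1)"
  define B where "B = 4 * T + 11 + 2 * (Suc C * (T + 5))"
  have out: "program_output f T C n = arr s2 ''a''"
    and time: "running_time f T C n = snd (exec f T pre (input_store C n)) + snd (exec f T loop s1)"
    by (simp_all add: program_output_def running_time_def double_greedy_program_def pre_def loop_def
        round_body_def s1_def s2_def exec_Seq del: exec.simps)
  \<comment> \<open>Besides matching the abstract state, the loop must preserve \<open>m\<close>,
    the bound that each scan reads afresh. The counter \<open>k\<close> is set by the loop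
    itself.\<close>
  define I where "I j u \<longleftrightarrow> nreg u ''m'' = Suc C \<and>
    (arr u ''a'', arr u ''b'') = greedy_state f C n j" for j and u :: store
  \<comment> \<open>The two allocations cost 1 + n each and the addition costs 1.\<close>
  have pre: "I 0 s1" "nreg s1 ''n'' = n" "snd (exec f T pre (input_store C n)) = 3 + 2 * n"
    by (simp_all add: I_def s1_def pre_def input_store_def exec_defs)
  have step: "I (Suc j) (fst (exec f T round_body (set_nreg ''k'' j u))) \<and>
      snd (exec f T round_body (set_nreg ''k'' j u)) \<le> B"
    if "I j u" for j u
    using that exec_round_body[of "set_nreg ''k'' j u" j C f T]
    by (simp add: I_def B_def set_nreg_def)
  have loop: "I n s2" "snd (exec f T loop s1) \<le> 1 + n * (B + 1)"
    using exec_For_invariant[of "Reg ''n''" s1 n I f T round_body "''k''" B] pre step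
    by (simp_all add: loop_def s2_def del: exec.simps(12))
  show "program_output f T C n = double_greedy f C n"
    using loop(1) unfolding out double_greedy_def I_def by (metis fst_conv)
  show "running_time f T C n \<le> 4 + 2 * n + n * (4 * T + 12 + 2 * (Suc C * (T + 5)))"
    using loop(2) by (simp add: time pre(3) B_def algebra_simps)
qed

section \<open>Absorbing lower-order terms into C * n * T\<close>

lemma running_time_bound:
  assumes "C \<ge> 1" "n \<ge> 1" "T \<ge> 1"
  shows "running_time f T C n \<le> 46 * (C * n * T)"
proof -
  have CT: "1 \<le> C * T" "T \<le> C * T" "C \<le> C * T"
    using assms by simp_all
  have "4 * T + 12 + 2 * (Suc C * (T + 5)) = 6 * T + 22 + 10 * C + 2 * (C * T)"
    by (simp add: algebra_simps)
  \<comment> \<open>Each of 1, T and C is at most C * T, so the coefficients add up: 6 + 22 + 10 + 2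
    = 40.\<close>
  also have "\<dots> \<le> 40 * (C * T)"
    using CT by linarith
  finally have "n * (4 * T + 12 + 2 * (Suc C * (T + 5))) \<le> n * (40 * (C * T))"
    by (rule mult_le_mono2)
  \<comment> \<open>The cost outside the rounds is at most 6 * n because \<open>n\<close> \<ge> 1;
    together with the 40 per round this yields 46.\<close>
  moreover have "4 + 2 * n \<le> n * (6 * (C * T))"
  proof -
    have "n * 6 \<le> n * (6 * (C * T))"
      using CT(1) by (intro mult_le_mono2) simp
    then show ?thesis
      using \<open>n \<ge> 1\<close> by linarith
  qed
  ultimately show ?thesis
    using exec_double_greedy_program(2)[of f T C n] by (simp add: algebra_simps)
qed

theorem theorem2:
  shows "(\<forall>(C::nat) (n::nat) (f :: nat list \<Rightarrow> real).
            C \<ge> 1 \<and> n \<ge> 1 \<and> submodular C n f \<and> (\<forall>x\<in>box C n. f x \<ge> 0) \<longrightarrow>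
              double_greedy f C n \<in> box C n \<and>
              f (double_greedy f C n) \<ge> 1 / 3 * Max (f ` box C n)) \<and>
         (\<exists>K::nat. \<forall>(C::nat) (n::nat) (f :: nat list \<Rightarrow> real) (T::nat).
            C \<ge> 1 \<and> n \<ge> 1 \<and> T \<ge> 1 \<and> submodular C n f \<and> (\<forall>x\<in>box C n. f x \<ge> 0) \<longrightarrow>
              program_output f T C n = double_greedy f C n \<and>
              running_time f T C n \<le> K * (C * n * T))"
  using double_greedy_approx exec_double_greedy_program(1) running_time_bound by blast

end
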